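(* Let $g:\mathbb{R}\to\mathbb{R}$ be a derivator, $\mathbb{F}\in\{\mathbb{R},\mathbb{C}\}$, and $\Omega\subset\mathbb{R}$ open in the usual topology. Say that a function $f:\Omega\to\mathbb{F}$ has property (H) if for all $y\in\Omega$ there exist $\delta>0$ and $t\in\mathbb{R}$ such that $y\in(t,t+\delta)$ and $g^C(y)<g^C(t+\delta)$, and a sequence $\{a_n\}_{n=0}^\infty\subset\mathbb{F}$ satisfying $$f(x)=\sum_{n=0}^\infty a_n g_{t,n}(x)$$ for all $x\in(t,t+\delta)\subset\Omega$, the sum converging absolutely. If $f:\Omega\to\mathbb{F}$ is a Stieltjes-analytic function that has property (H), then: (i) $\Omega$ satisfies the condition: whenever $x\in\Omega$ belongs to a connected component $(a_n,b_n)$ of $C_g$, then $b_n\in\Omega$; (ii) $f$ is $g$-differentiable on $\Omega$; (iii) $f'_g:\Omega\to\mathbb{F}$ is again a Stieltjes-analytic function that has property (H).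
   Context: A derivator is a left-continuous non-decreasing function $g:\mathbb{R}\to\mathbb{R}$; $\Delta g(x)=g(x^+)-g(x)$. $\mu_g$ denotes its Lebesgue–Stieltjes measure, characterized on Borel sets by $\mu_g([a,b))=g(b)-g(a)$ for $a<b$. $g$-monomials centered at $t\in\mathbb{R}$: $g_{t,0}\equiv 1$ and, for $n\ge 1$, $g_{t,n}(x)=n\int_{[t,x)}g_{t,n-1}\,d\mu_g$ if $x\ge t$ and $g_{t,n}(x)=-n\int_{[x,t)}g_{t,n-1}\,d\mu_g$ if $x<t$. The discontinuous part of $g$ is $g^B(x)=\sum_{s\in[0,x)}\Delta g(s)$ for $x>0$ and $g^B(x)=-\sum_{s\in[x,0)}\Delta g(s)$ for $x\le 0$; the continuous part is $g^C=g-g^B$. Stieltjes-analytic: for $\Omega$ open in the usual topology, $f:\Omega\to\mathbb{F}$ is Stieltjes-analytic on $\Omega$ if for all $y\in\Omega$ there exist $\delta>0$ and $t\in\mathbb{R}$ with $y\in(t,t+\delta)\subset\Omega$, and a sequence $\{a_n\}_{n=0}^\infty\subset\mathbb{F}$, such that $f(x)=\sum_{n=0}^\infty a_n g_{t,n}(x)$ for all $x\in(t,t+\delta)$, the sum converging absolutely. Put $D_g=\{x:\Delta g(x)>0\}$, $C_g=\{x: g$ is constant on $(x-\varepsilon,x+\varepsilon)$ for some $\varepsilon>0\}$. Write the open set $C_g$ as the disjoint union of its connected components $(a_n,b_n)$, $n\in\Lambda\subset\mathbb N$ (with $a_n,b_n\in\mathbb{R}\cup\{\pm\infty\}$). Set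 $N_g^-=\{a_n\}_{n\in\Lambda}\setminus D_g$, $N_g^+=\{b_n\}_{n\in\Lambda}\setminus D_g$. $g$-derivative: for $\Omega$ open satisfying the condition in (i), $f:\Omega\to\mathbb{F}$ and $x\in\Omega$ (when the limit exists): $f'_g(x)=\lim_{y\to x^+}\frac{f(y)-f(x)}{g(y)-g(x)}$ if $x\in D_g$; $f'_g(x)=\lim_{y\to x}\frac{f(y)-f(x)}{g(y)-g(x)}$ if $x\notin D_g\cup C_g$, where the limit is taken only from the right if $x\in N_g^+$ and only from the left if $x\in N_g^-$; $f'_g(x)=\lim_{y\to b_n^+}\frac{f(y)-f(b_n)}{g(y)-g(b_n)}$ if $x\in(a_n,b_n)$, a component of $C_g$. $f$ is $g$-differentiable on $\Omega$ if $f'_g(x)$ exists for every $x\in\Omega$. *)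

theory Defs
  imports "HOL-Analysis.Analysis"
begin

definition derivator :: "(real \<Rightarrow> real) \<Rightarrow> bool" where
  "derivator g \<longleftrightarrow> mono g \<and> (\<forall>x. continuous (at_left x) g)"

definition jump :: "(real \<Rightarrow> real) \<Rightarrow> real \<Rightarrow> real" where
  "jump g x = Lim (at_right x) g - g x"

text \<open>
  The library's \<^const>\<open>interval_measure\<close> is for right-continuous functions and half-open
  intervals \<open>(a, b]\<close>. The measure for a left-continuous \<open>g\<close> and intervals \<open>[a, b)\<close>
  is its image under reflection; \<open>emeasure_stieltjes_measure\<close> is the characterising property.
\<close>

definition stieltjes_measure :: "(real \<Rightarrow> real) \<Rightarrow> real measure" where
  "stieltjes_measure g = distr (interval_measure (\<lambda>x. - g (- x))) borel uminus"

lemma sets_stieltjes_measure [simp, measurable_cong]: "sets (stieltjes_measure g) = sets borel"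
  and space_stieltjes_measure [simp]: "space (stieltjes_measure g) = UNIV"
  by (simp_all add: stieltjes_measure_def)

lemma emeasure_stieltjes_measure:
  assumes "derivator g" "a \<le> b"
  shows "emeasure (stieltjes_measure g) {a..<b} = ennreal (g b - g a)"
proof -
  have mono: "- g (- x) \<le> - g (- y)" if "x \<le> y" for x y
    using assms(1) that by (simp add: derivator_def monoD)
  have cont: "continuous (at_right x) (\<lambda>x. - g (- x))" for x
  proof -
    have "(g \<longlongrightarrow> g (- x)) (at_left (- x))"
      using assms(1) by (simp add: derivator_def continuous_within)
    then have "((\<lambda>y. g (- y)) \<longlongrightarrow> g (- x)) (at_right x)"
      by (simp add: filterlim_at_left_to_right)
    then show ?thesis
      by (simp add: continuous_within tendsto_minus)
  qed
  have "emeasure (stieltjes_measure g) {a..<b}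
      = emeasure (interval_measure (\<lambda>x. - g (- x))) {- b<..- a}"
    unfolding stieltjes_measure_def
    by (subst emeasure_distr) (auto intro!: arg_cong2[where f = emeasure])
  also have "\<dots> = ennreal (g b - g a)"
    using assms(2) mono cont by (subst emeasure_interval_measure_Ioc) auto
  finally show ?thesis .
qed

primrec g_monomial :: "(real \<Rightarrow> real) \<Rightarrow> real \<Rightarrow> nat \<Rightarrow> real \<Rightarrow> real" where
  "g_monomial g t 0 = (\<lambda>x. 1)"
| "g_monomial g t (Suc n) = (\<lambda>x.
     if t \<le> x then real (Suc n) * (LINT s:{t..<x}|stieltjes_measure g. g_monomial g t n s)
     else - real (Suc n) * (LINT s:{x..<t}|stieltjes_measure g. g_monomial g t n s))"

definition disc_part :: "(real \<Rightarrow> real) \<Rightarrow> real \<Rightarrow> real" where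
  "disc_part g x = (if x > 0 then (\<Sum>\<^sub>\<infinity>s\<in>{0..<x}. jump g s) else - (\<Sum>\<^sub>\<infinity>s\<in>{x..<0}. jump g s))"

definition cont_part :: "(real \<Rightarrow> real) \<Rightarrow> real \<Rightarrow> real" where
  "cont_part g x = g x - disc_part g x"

text \<open>
  A function \<open>\<Omega> \<rightarrow> F\<close> is represented by a function on all of \<open>\<real>\<close> whose values
  outside \<open>\<Omega>\<close> are irrelevant.
\<close>

definition g_series_on ::
  "(real \<Rightarrow> real) \<Rightarrow> real \<Rightarrow> (nat \<Rightarrow> 'a) \<Rightarrow> (real \<Rightarrow> 'a::real_normed_field) \<Rightarrow> real set \<Rightarrow> bool" where
  "g_series_on g t a f I \<longleftrightarrow>
     (\<forall>x\<in>I. summable (\<lambda>n. norm (a n * of_real (g_monomial g t n x)))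
          \<and> (\<lambda>n. a n * of_real (g_monomial g t n x)) sums f x)"

definition stieltjes_analytic_on ::
  "(real \<Rightarrow> real) \<Rightarrow> real set \<Rightarrow> (real \<Rightarrow> 'a::real_normed_field) \<Rightarrow> bool" where
  "stieltjes_analytic_on g \<Omega> f \<longleftrightarrow>
     (\<forall>y\<in>\<Omega>. \<exists>\<delta>>0. \<exists>t. y \<in> {t<..<t + \<delta>} \<and> {t<..<t + \<delta>} \<subseteq> \<Omega>
        \<and> (\<exists>a. g_series_on g t a f {t<..<t + \<delta>}))"

definition property_H ::
  "(real \<Rightarrow> real) \<Rightarrow> real set \<Rightarrow> (real \<Rightarrow> 'a::real_normed_field) \<Rightarrow> bool" where
  "property_H g \<Omega> f \<longleftrightarrow>
     (\<forall>y\<in>\<Omega>. \<exists>\<delta>>0. \<exists>t. y \<in> {t<..<t + \<delta>} \<and> cont_part g y < cont_part g (t + \<delta>)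
        \<and> {t<..<t + \<delta>} \<subseteq> \<Omega> \<and> (\<exists>a. g_series_on g t a f {t<..<t + \<delta>}))"

definition jump_set :: "(real \<Rightarrow> real) \<Rightarrow> real set" where
  "jump_set g = {x. jump g x > 0}"

definition constancy_set :: "(real \<Rightarrow> real) \<Rightarrow> real set" where
  "constancy_set g = {x. \<exists>\<epsilon>>0. g constant_on {x - \<epsilon><..<x + \<epsilon>}}"

text \<open>
  A component \<open>C\<close> of the open set \<open>constancy_set g\<close> is an open interval, possibly unbounded;
  its end points are the infimum and supremum of \<open>C\<close> in the extended reals.
\<close>

definition left_end :: "real set \<Rightarrow> ereal" where
  "left_end C = Inf (ereal ` C)"

definition right_end :: "real set \<Rightarrow> ereal" where
  "right_end C = Sup (ereal ` C)"

definition N_minus :: "(real \<Rightarrow> real) \<Rightarrow> real set" where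
  "N_minus g = {x. \<exists>C\<in>components (constancy_set g). ereal x = left_end C} - jump_set g"

definition N_plus :: "(real \<Rightarrow> real) \<Rightarrow> real set" where
  "N_plus g = {x. \<exists>C\<in>components (constancy_set g). ereal x = right_end C} - jump_set g"

text \<open>In particular, \<open>\<Omega>\<close> must not meet a component of \<open>constancy_set g\<close> unbounded to the right.\<close>

definition contains_right_ends :: "(real \<Rightarrow> real) \<Rightarrow> real set \<Rightarrow> bool" where
  "contains_right_ends g \<Omega> \<longleftrightarrow>
     (\<forall>x\<in>\<Omega>. \<forall>C\<in>components (constancy_set g). x \<in> C \<longrightarrow> right_end C \<in> ereal ` \<Omega>)"

definition g_quotient :: "(real \<Rightarrow> real) \<Rightarrow> (real \<Rightarrow> 'a::real_normed_field) \<Rightarrow> real \<Rightarrow> real \<Rightarrow> 'a" where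
  "g_quotient g f x y = (f y - f x) / of_real (g y - g x)"

text \<open>
  For \<open>x \<in> \<Omega>\<close>, with \<open>\<Omega>\<close> open and containing right ends, every base point below lies in \<open>\<Omega>\<close>,
  so the limits only involve values of \<open>f\<close> on \<open>\<Omega>\<close>. The denominators are eventually
  nonzero along the chosen filters; \<open>N_plus g\<close> and \<open>N_minus g\<close> are disjoint.
\<close>

definition has_g_derivative ::
  "(real \<Rightarrow> real) \<Rightarrow> (real \<Rightarrow> 'a::real_normed_field) \<Rightarrow> real \<Rightarrow> 'a \<Rightarrow> bool" where
  "has_g_derivative g f x L \<longleftrightarrow>
     (if x \<in> jump_set g then (g_quotient g f x \<longlongrightarrow> L) (at_right x)
      else if x \<in> constancy_set g then
        (\<exists>C\<in>components (constancy_set g). \<exists>b. x \<in> C \<and> right_end C = ereal b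
           \<and> (g_quotient g f b \<longlongrightarrow> L) (at_right b))
      else if x \<in> N_plus g then (g_quotient g f x \<longlongrightarrow> L) (at_right x)
      else if x \<in> N_minus g then (g_quotient g f x \<longlongrightarrow> L) (at_left x)
      else (g_quotient g f x \<longlongrightarrow> L) (at x))"

definition g_deriv :: "(real \<Rightarrow> real) \<Rightarrow> (real \<Rightarrow> 'a::real_normed_field) \<Rightarrow> real \<Rightarrow> 'a" where
  "g_deriv g f x = (THE L. has_g_derivative g f x L)"

definition g_differentiable_on ::
  "(real \<Rightarrow> real) \<Rightarrow> (real \<Rightarrow> 'a::real_normed_field) \<Rightarrow> real set \<Rightarrow> bool" where
  "g_differentiable_on g f \<Omega> \<longleftrightarrow> (\<forall>x\<in>\<Omega>. \<exists>L. has_g_derivative g f x L)"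

end

theory Submission imports Defs begin

text \<open>
  Let \<open>f = (\<Sum>n. a\<^sub>n g\<^sub>t\<^sub>,\<^sub>n)\<close> converge absolutely on \<open>(t, r)\<close>. The derivative series
  \<open>\<Sum>n. (n + 1) a\<^sub>n\<^sub>+\<^sub>1 g\<^sub>t\<^sub>,\<^sub>n\<close> converges absolutely at every \<open>x\<close> for which
  some \<open>z < r\<close> has \<open>g x < g z\<close>, because
  \<open>g\<^sub>t\<^sub>,\<^sub>n\<^sub>+\<^sub>1(z) \<ge> (n + 1) g\<^sub>t\<^sub>,\<^sub>n(x) (g z - g x)\<close>. Since difference quotients of
  \<open>g\<^sub>t\<^sub>,\<^sub>n\<^sub>+\<^sub>1\<close> on \<open>[t, v]\<close> are at most \<open>(n + 1) g\<^sub>t\<^sub>,\<^sub>n(v)\<close>, Tannery's theorem identifies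
  its sum with the \<open>g\<close>-derivative of \<open>f\<close>. Continuity of \<open>g\<^sup>C\<close> is what makes property (H)
  strong enough: by the intermediate value theorem, \<open>g\<^sup>C y < g\<^sup>C r\<close> leaves room for further points
  \<open>y < w < z < r\<close> along which \<open>g\<^sup>C\<close>, and hence \<open>g\<close>, strictly increases. The mere
  inequality \<open>g y < g r\<close> could be due to a single jump and would not.
\<close>

section \<open>One-sided limits of a derivator and atoms of its measure\<close>

locale stieltjes_derivator =
  fixes g :: "real \<Rightarrow> real"
  assumes derivator_g: "derivator g"
begin

lemma derivator_le: "x \<le> y \<Longrightarrow> g x \<le> g y"
  using derivator_g by (simp add: derivator_def monoD)

lemma derivator_tendsto_left: "(g \<longlongrightarrow> g x) (at_left x)"
  using derivator_g by (simp add: derivator_def continuous_within)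

lemma measure_Ico: "a \<le> b \<Longrightarrow> measure (stieltjes_measure g) {a..<b} = g b - g a"
  using emeasure_stieltjes_measure[OF derivator_g, of a b] derivator_le[of a b]
  by (simp add: measure_def)

lemma fmeasurable_bounded:
  assumes "A \<in> sets borel" "A \<subseteq> {a..<b}"
  shows "A \<in> fmeasurable (stieltjes_measure g)"
proof -
  \<comment> \<open>The maximum keeps the interval formula applicable when \<open>b < a\<close>,
    where \<open>A\<close> is empty.\<close>
  have "emeasure (stieltjes_measure g) A \<le> emeasure (stieltjes_measure g) {a..<max a b}"
    using assms by (intro emeasure_mono) auto
  then show ?thesis
    using assms emeasure_stieltjes_measure[OF derivator_g, of a "max a b"]
    by (intro fmeasurableI) (auto simp: le_less_trans)
qed

lemma measure_singleton_le: "x < y \<Longrightarrow> measure (stieltjes_measure g) {x} \<le> g y - g x"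
  using measure_mono_fmeasurable[of "{x}" "{x..<y}" "stieltjes_measure g"]
    fmeasurable_bounded[of "{x..<y}" x y]
  by (simp add: measure_Ico)

text \<open>Continuity of the measure from above, along the intervals \<open>{x..<S n}\<close> that
  shrink to \<open>{x}\<close>. It shows that the limit in the definition of \<open>jump\<close>
  exists and that a jump is the mass of an atom.\<close>

lemma derivator_tendsto_right:
  "(g \<longlongrightarrow> g x + measure (stieltjes_measure g) {x}) (at_right x)"
proof (rule tendsto_at_right_sequentially[of x "x + 1"])
  fix S :: "nat \<Rightarrow> real"
  assume S: "\<And>n. x < S n" "decseq S" "S \<longlonglongrightarrow> x"
  have "(\<Inter>n. {x..<S n}) = {x}"
  proof -
    have "y \<le> x" if "\<forall>n. y < S n" for y
      using that by (intro LIMSEQ_le_const[OF S(3)]) (auto intro: less_imp_le)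
    then show ?thesis using S(1) by (auto intro!: antisym)
  qed
  moreover have "(\<lambda>n. measure (stieltjes_measure g) {x..<S n})
      \<longlonglongrightarrow> measure (stieltjes_measure g) (\<Inter>n. {x..<S n})"
    using S(1,2) emeasure_stieltjes_measure[OF derivator_g, of x "S _"]
    by (intro Lim_measure_decseq) (auto simp: decseq_def less_imp_le intro: order.strict_trans2)
  ultimately have "(\<lambda>n. g (S n) - g x) \<longlonglongrightarrow> measure (stieltjes_measure g) {x}"
    using S(1) by (simp add: measure_Ico less_imp_le)
  from tendsto_add[OF tendsto_const[of "g x"] this]
  show "(\<lambda>n. g (S n)) \<longlonglongrightarrow> g x + measure (stieltjes_measure g) {x}"
    by simp
qed simp

lemma jump_eq_measure: "jump g x = measure (stieltjes_measure g) {x}"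
  using tendsto_Lim[OF _ derivator_tendsto_right[of x]] by (simp add: jump_def)

lemma jump_nonneg: "0 \<le> jump g x"
  by (simp add: jump_eq_measure)

lemma jump_le: "x < y \<Longrightarrow> jump g x \<le> g y - g x"
  by (simp add: jump_eq_measure measure_singleton_le)

lemma derivator_increment_tendsto_jump: "((\<lambda>y. g y - g x) \<longlongrightarrow> jump g x) (at_right x)"
  using tendsto_diff[OF derivator_tendsto_right[of x] tendsto_const[of "g x"]]
  by (simp add: jump_eq_measure)

lemma derivator_increment_tendsto_0: "((\<lambda>y. g x - g y) \<longlongrightarrow> 0) (at_left x)"
  using tendsto_diff[OF tendsto_const[of "g x"] derivator_tendsto_left[of x]] by simp

section \<open>Sums of jumps and the continuous part\<close>

lemma sum_jump_le:
  assumes "finite F" "F \<subseteq> {a..<b}" "a \<le> b"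
  shows "sum (jump g) F \<le> g b - g a"
proof -
  have sing: "{x} \<in> fmeasurable (stieltjes_measure g)" for x
    by (rule fmeasurable_bounded[of _ x "x + 1"]) auto
  have "sum (jump g) F = measure (stieltjes_measure g) F"
    using assms sing by (subst measure_eq_sum_singleton)
      (auto simp: jump_eq_measure fmeasurable_def less_top[symmetric])
  also have "\<dots> \<le> measure (stieltjes_measure g) {a..<b}"
    using assms fmeasurable_bounded[of "{a..<b}" a b]
    by (intro measure_mono_fmeasurable) (auto intro: borel_closed finite_imp_closed)
  finally show ?thesis using assms by (simp add: measure_Ico)
qed

lemma jump_summable: "jump g summable_on {a..<b}"
proof (cases "a \<le> b")
  case True
  then show ?thesis
    using sum_jump_le[of _ a b] jump_nonneg
    by (intro nonneg_bdd_above_summable_on bdd_aboveI[of _ "g b - g a"]) auto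
qed simp

lemma infsum_jump_le: "a \<le> b \<Longrightarrow> infsum (jump g) {a..<b} \<le> g b - g a"
  by (rule infsum_le_finite_sums[OF jump_summable]) (rule sum_jump_le)

lemma infsum_jump_split:
  assumes "a \<le> b" "b \<le> c"
  shows "infsum (jump g) {a..<c} = infsum (jump g) {a..<b} + infsum (jump g) {b..<c}"
  using assms ivl_disj_un_two(3)[of a b c]
  by (subst infsum_Un_disjoint[symmetric]) (auto intro: jump_summable)

text \<open>The base point 0 of \<open>disc_part\<close> cancels in increments; the three splittings
  cover 0 to the left of, to the right of, or inside the interval.\<close>

lemma cont_part_increment:
  assumes "a \<le> b"
  shows "cont_part g b - cont_part g a = g b - g a - infsum (jump g) {a..<b}"
  using assms infsum_jump_split[of 0 a b] infsum_jump_split[of a b 0] infsum_jump_split[of a 0 b]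
  by (auto simp: cont_part_def disc_part_def not_less)

lemma cont_part_increment_le: "a \<le> b \<Longrightarrow> cont_part g b - cont_part g a \<le> g b - g a"
  using jump_nonneg by (simp add: cont_part_increment infsum_nonneg)

lemma cont_part_le: "a \<le> b \<Longrightarrow> cont_part g a \<le> cont_part g b"
  using infsum_jump_le[of a b] cont_part_increment[of a b] by simp

lemma cont_part_eq: "a \<le> b \<Longrightarrow> g a = g b \<Longrightarrow> cont_part g a = cont_part g b"
  using cont_part_le[of a b] cont_part_increment_le[of a b] by simp

text \<open>On the left, increments of the continuous part are dominated by those of
  \<open>g\<close>, which vanish by left-continuity. On the right, the dominating quantity is the
  increment of \<open>g\<close> minus the jump at \<open>x\<close>.\<close>

lemma isCont_cont_part: "isCont (cont_part g) x"
proof -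
  have "((\<lambda>y. cont_part g x - cont_part g y) \<longlongrightarrow> 0) (at_left x)"
    by (rule tendsto_sandwich[OF _ _ tendsto_const derivator_increment_tendsto_0])
      (auto simp: eventually_at_filter cont_part_le cont_part_increment_le)
  from tendsto_diff[OF tendsto_const[of "cont_part g x"] this]
  have left: "(cont_part g \<longlongrightarrow> cont_part g x) (at_left x)"
    by simp
  \<comment> \<open>The jump at \<open>x\<close> is one term of the sum over \<open>{x..<y}\<close>.
    Subtracting it makes the bound tend to 0 even if \<open>g\<close> jumps at
    \<open>x\<close>.\<close>
  have upper: "cont_part g y - cont_part g x \<le> g y - g x - jump g x" if "x < y" for y
    using cont_part_increment[of x y] that finite_sum_le_infsum[OF jump_summable, of "{x}" x y]
      jump_nonneg by simp
  have "((\<lambda>y. g y - g x - jump g x) \<longlongrightarrow> 0) (at_right x)"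
    using tendsto_diff[OF derivator_increment_tendsto_jump[of x] tendsto_const[of "jump g x"]]
    by simp
  then have "((\<lambda>y. cont_part g y - cont_part g x) \<longlongrightarrow> 0) (at_right x)"
    by (rule tendsto_sandwich[OF _ _ tendsto_const, rotated 2])
      (auto simp: eventually_at_filter cont_part_le upper)
  from tendsto_add[OF tendsto_const[of "cont_part g x"] this]
  have "(cont_part g \<longlongrightarrow> cont_part g x) (at_right x)"
    by simp
  with left show ?thesis
    by (simp add: isCont_def filterlim_split_at_real)
qed

text \<open>Intermediate value theorem, applied to the mean of the two end values.\<close>

lemma cont_part_between:
  assumes "a \<le> b" "cont_part g a < cont_part g b"
  obtains c where "a < c" "c < b" "cont_part g a < cont_part g c" "cont_part g c < cont_part g b"
proof -
  define m where "m = (cont_part g a + cont_part g b) / 2"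
  have m: "cont_part g a < m" "m < cont_part g b"
    using assms(2) by (auto simp: m_def)
  then obtain c where c: "a \<le> c" "c \<le> b" "cont_part g c = m"
    using IVT[of "cont_part g" a m b] assms(1) isCont_cont_part by force
  with m have "a \<noteq> c" "c \<noteq> b" by auto
  with c m show thesis by (intro that[of c]) auto
qed

subsection \<open>Increments of the monomials\<close>

lemma integrable_indicator_bounded:
  assumes "A \<in> sets borel" "A \<subseteq> {a..<b}"
  shows "integrable (stieltjes_measure g) (\<lambda>s. indicator A s * (c :: real))"
  using fmeasurable_bounded[OF assms]
  by (intro integrable_mult_left integrable_real_indicator) (auto simp: fmeasurable_def)

text \<open>As \<open>h\<close> is monotone only from \<open>t\<close> on, it is replaced by
  \<open>\<lambda>s. h (max t s)\<close>, which is monotone on the whole line and therefore Borel.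
  On \<open>{x..<y}\<close>, a set of finite measure, \<open>h\<close> is bounded by the constant
  \<open>h y\<close>.\<close>

lemma set_integrable_mono_nonneg:
  fixes h :: "real \<Rightarrow> real"
  assumes nonneg: "\<And>x. t \<le> x \<Longrightarrow> 0 \<le> h x"
    and mono: "\<And>x y. t \<le> x \<Longrightarrow> x \<le> y \<Longrightarrow> h x \<le> h y"
    and "t \<le> x"
  shows "set_integrable (stieltjes_measure g) {x..<y} h"
proof -
  have "mono (\<lambda>s. h (max t s))"
    by (rule monoI) (auto intro!: mono)
  then have "(\<lambda>s. h (max t s)) \<in> borel_measurable borel"
    by (rule borel_measurable_mono)
  then have "(\<lambda>s. indicator {x..<y} s *\<^sub>R h (max t s)) \<in> borel_measurable (stieltjes_measure g)"
    by measurable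
  moreover have "(\<lambda>s. indicator {x..<y} s *\<^sub>R h (max t s)) = (\<lambda>s. indicator {x..<y} s *\<^sub>R h s)"
    using \<open>t \<le> x\<close> by (auto simp: indicator_def max_def)
  ultimately have meas:
    "(\<lambda>s. indicator {x..<y} s *\<^sub>R h s) \<in> borel_measurable (stieltjes_measure g)"
    by simp
  have "integrable (stieltjes_measure g) (\<lambda>s. indicator {x..<y} s * h y)"
    by (rule integrable_indicator_bounded[of _ x y]) auto
  then show ?thesis
    unfolding set_integrable_def
    by (rule Bochner_Integration.integrable_bound[OF _ meas])
      (use \<open>t \<le> x\<close> nonneg mono in \<open>auto simp: indicator_def intro!: AE_I2\<close>)
qed

text \<open>Both claims go through one induction: integrability of the \<open>n\<close>-th monomial
  rests on both, and the next monomial is monotone because the integral over the added interval is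
  nonnegative.\<close>

lemma g_monomial_nonneg_mono:
  "(\<forall>x\<ge>t. 0 \<le> g_monomial g t n x) \<and>
   (\<forall>x\<ge>t. \<forall>y\<ge>x. g_monomial g t n x \<le> g_monomial g t n y)"
proof (induction n)
  case (Suc n)
  have integrable: "set_integrable (stieltjes_measure g) {x..<y} (g_monomial g t n)"
    if "t \<le> x" for x y
    using Suc that by (intro set_integrable_mono_nonneg) auto
  have nonneg: "0 \<le> (LINT s:{x..<y}|stieltjes_measure g. g_monomial g t n s)" if "t \<le> x" for x y
    using that Suc unfolding set_lebesgue_integral_def
    by (intro Bochner_Integration.integral_nonneg) (auto simp: indicator_def)
  have "(LINT s:{t..<x}|stieltjes_measure g. g_monomial g t n s)
      \<le> (LINT s:{t..<y}|stieltjes_measure g. g_monomial g t n s)" if "t \<le> x" "x \<le> y" for x y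
    using that ivl_disj_un_two(3)[of t x y] nonneg[of x y]
      set_integral_Un[OF _ integrable[of t x] integrable[of x y]] by auto
  with nonneg show ?case
    by (auto intro!: mult_left_mono)
qed simp

lemma g_monomial_nonneg: "t \<le> x \<Longrightarrow> 0 \<le> g_monomial g t n x"
  and g_monomial_mono: "t \<le> x \<Longrightarrow> x \<le> y \<Longrightarrow> g_monomial g t n x \<le> g_monomial g t n y"
  using g_monomial_nonneg_mono by blast+

lemma set_integrable_g_monomial:
  "t \<le> x \<Longrightarrow> set_integrable (stieltjes_measure g) {x..<y} (g_monomial g t n)"
  by (rule set_integrable_mono_nonneg[of t]) (auto intro: g_monomial_nonneg g_monomial_mono)

lemma g_monomial_Suc_diff:
  assumes "t \<le> x" "x \<le> y"
  shows "g_monomial g t (Suc n) y - g_monomial g t (Suc n) x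
    = real (Suc n) * (LINT s:{x..<y}|stieltjes_measure g. g_monomial g t n s)"
  using assms ivl_disj_un_two(3)[of t x y]
    set_integral_Un[OF _ set_integrable_g_monomial[of t t x n] set_integrable_g_monomial[of t x y n]]
  by (auto simp: algebra_simps)

text \<open>On \<open>{x..<y}\<close> the integrand is at least its value at
  \<open>x\<close>.\<close>

lemma g_monomial_Suc_diff_ge:
  assumes "t \<le> x" "x \<le> y"
  shows "real (Suc n) * (g_monomial g t n x * (g y - g x))
    \<le> g_monomial g t (Suc n) y - g_monomial g t (Suc n) x"
proof -
  have "(\<integral>s. indicator {x..<y} s * g_monomial g t n x \<partial>stieltjes_measure g)
    \<le> (\<integral>s. indicator {x..<y} s * g_monomial g t n s \<partial>stieltjes_measure g)"
    using assms set_integrable_g_monomial[of t x y n]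
    by (intro integral_mono integrable_indicator_bounded[of _ x y])
      (auto simp: set_integrable_def indicator_def intro: g_monomial_mono)
  then show ?thesis
    using assms unfolding g_monomial_Suc_diff[OF assms] set_lebesgue_integral_def
    by (intro mult_left_mono) (auto simp: measure_Ico algebra_simps)
qed

text \<open>The integrand is bounded by its value at \<open>z\<close>, except at the atom
  \<open>x\<close>, where the exact value is kept. This precision yields the correct limit of
  difference quotients at jumps.\<close>

lemma g_monomial_Suc_diff_le_jump:
  assumes "t \<le> x" "x < y" "y \<le> z"
  shows "g_monomial g t (Suc n) y - g_monomial g t (Suc n) x
    \<le> real (Suc n) * (g_monomial g t n x * jump g x + g_monomial g t n z * (g y - g x - jump g x))"
proof -
  let ?M = "g_monomial g t n" and ?\<mu> = "stieltjes_measure g"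
  have int: "integrable ?\<mu> (\<lambda>s. indicator {x..<y} s * ?M z)"
    "integrable ?\<mu> (\<lambda>s. indicator {x} s * (?M z - ?M x))"
    by (rule integrable_indicator_bounded[of _ x y]; use assms in auto)+
  have "(\<integral>s. indicator {x..<y} s * ?M s \<partial>?\<mu>)
    \<le> (\<integral>s. indicator {x..<y} s * ?M z - indicator {x} s * (?M z - ?M x) \<partial>?\<mu>)"
    using assms set_integrable_g_monomial[of t x y n]
    by (intro integral_mono Bochner_Integration.integrable_diff int)
      (auto simp: set_integrable_def indicator_def intro: g_monomial_mono)
  also have "\<dots> = ?M z * (g y - g x) - (?M z - ?M x) * jump g x"
    using assms by (subst Bochner_Integration.integral_diff[OF int])
      (auto simp: measure_Ico jump_eq_measure)
  also have "\<dots> = ?M x * jump g x + ?M z * (g y - g x - jump g x)"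
    by (simp add: algebra_simps)
  finally show ?thesis
    using assms unfolding g_monomial_Suc_diff[OF assms(1) less_imp_le[OF assms(2)]]
      set_lebesgue_integral_def
    by (intro mult_left_mono) auto
qed

lemma g_monomial_Suc_diff_le:
  assumes "t \<le> x" "x \<le> y" "y \<le> z"
  shows "g_monomial g t (Suc n) y - g_monomial g t (Suc n) x
    \<le> real (Suc n) * (g_monomial g t n z * (g y - g x))"
proof (cases "x = y")
  case False
  with assms have "g_monomial g t n x * jump g x \<le> g_monomial g t n z * jump g x"
    using jump_nonneg by (intro mult_right_mono g_monomial_mono) auto
  then have "real (Suc n) * (g_monomial g t n x * jump g x
      + g_monomial g t n z * (g y - g x - jump g x)) \<le> real (Suc n) * (g_monomial g t n z * (g y - g x))"
    by (intro mult_left_mono) (auto simp: algebra_simps)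
  with False assms g_monomial_Suc_diff_le_jump[of t x y z n] show ?thesis
    by linarith
qed simp

lemma g_monomial_tendsto_left:
  assumes "t < x"
  shows "(g_monomial g t n \<longlongrightarrow> g_monomial g t n x) (at_left x)"
proof (cases n)
  case (Suc m)
  have ev: "\<forall>\<^sub>F y in at_left x. t < y \<and> y < x"
    using assms eventually_at_left_field by (force intro: exI[of _ t])
  have "((\<lambda>y. g_monomial g t n x - g_monomial g t n y) \<longlongrightarrow> 0) (at_left x)"
  proof (rule tendsto_sandwich[OF _ _ tendsto_const])
    show "((\<lambda>y. real (Suc m) * (g_monomial g t m x * (g x - g y))) \<longlongrightarrow> 0) (at_left x)"
      by (intro tendsto_mult_right_zero derivator_increment_tendsto_0)
    show "\<forall>\<^sub>F y in at_left x. 0 \<le> g_monomial g t n x - g_monomial g t n y"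
      using ev by eventually_elim (auto intro: g_monomial_mono)
    show "\<forall>\<^sub>F y in at_left x. g_monomial g t n x - g_monomial g t n y
        \<le> real (Suc m) * (g_monomial g t m x * (g x - g y))"
      using ev by eventually_elim (unfold Suc, auto intro: g_monomial_Suc_diff_le simp del: g_monomial.simps of_nat_Suc)
  qed
  from tendsto_diff[OF tendsto_const[of "g_monomial g t n x"] this] show ?thesis
    by simp
qed simp

lemma g_monomial_tendsto_right:
  assumes "t \<le> x" "jump g x = 0"
  shows "(g_monomial g t n \<longlongrightarrow> g_monomial g t n x) (at_right x)"
proof (cases n)
  case (Suc m)
  have ev: "\<forall>\<^sub>F y in at_right x. x < y \<and> y < x + 1"
    using eventually_at_right_field by (force intro: exI[of _ "x + 1"])
  have "((\<lambda>y. g_monomial g t n y - g_monomial g t n x) \<longlongrightarrow> 0) (at_right x)"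
  proof (rule tendsto_sandwich[OF _ _ tendsto_const])
    show "((\<lambda>y. real (Suc m) * (g_monomial g t m (x + 1) * (g y - g x))) \<longlongrightarrow> 0) (at_right x)"
      using derivator_increment_tendsto_jump[of x] assms(2) by (intro tendsto_mult_right_zero) simp
    show "\<forall>\<^sub>F y in at_right x. 0 \<le> g_monomial g t n y - g_monomial g t n x"
      using ev by eventually_elim (use assms in \<open>auto intro: g_monomial_mono\<close>)
    show "\<forall>\<^sub>F y in at_right x. g_monomial g t n y - g_monomial g t n x
        \<le> real (Suc m) * (g_monomial g t m (x + 1) * (g y - g x))"
      using ev by eventually_elim (use assms in \<open>unfold Suc, auto intro: g_monomial_Suc_diff_le simp del: g_monomial.simps of_nat_Suc\<close>)
  qed
  from tendsto_add[OF tendsto_const[of "g_monomial g t n x"] this] show ?thesis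
    by simp
qed simp

text \<open>The two increment estimates squeeze the quotient between the values at \<open>y\<close>
  and at \<open>x\<close>, and the monomial is left-continuous.\<close>

lemma g_quotient_g_monomial_left:
  assumes "t < x" "\<And>y. y < x \<Longrightarrow> g y < g x"
  shows "(g_quotient g (g_monomial g t (Suc n)) x \<longlongrightarrow> real (Suc n) * g_monomial g t n x) (at_left x)"
proof (rule tendsto_sandwich[OF _ _ _ tendsto_const])
  show "((\<lambda>y. real (Suc n) * g_monomial g t n y) \<longlongrightarrow> real (Suc n) * g_monomial g t n x) (at_left x)"
    by (intro tendsto_intros g_monomial_tendsto_left assms)
  have ev: "\<forall>\<^sub>F y in at_left x. t < y \<and> y < x"
    using assms eventually_at_left_field by (force intro: exI[of _ t])
  then show "\<forall>\<^sub>F y in at_left x.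
      real (Suc n) * g_monomial g t n y \<le> g_quotient g (g_monomial g t (Suc n)) x y"
  proof eventually_elim
    case (elim y)
    with g_monomial_Suc_diff_ge[of t y x n] assms(2)[of y] show ?case
      by (simp add: g_quotient_def field_simps del: g_monomial.simps of_nat_Suc)
  qed
  from ev show "\<forall>\<^sub>F y in at_left x.
      g_quotient g (g_monomial g t (Suc n)) x y \<le> real (Suc n) * g_monomial g t n x"
  proof eventually_elim
    case (elim y)
    with g_monomial_Suc_diff_le[of t y x x n] assms(2)[of y] show ?case
      by (simp add: g_quotient_def field_simps del: g_monomial.simps of_nat_Suc)
  qed
qed

text \<open>If \<open>g\<close> has no jump at \<open>x\<close>, the monomial is right-continuous
  there and the squeeze works as on the left. At a jump the denominator has a positive limit, and
  the estimate that separates the atom is used instead.\<close>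

lemma g_quotient_g_monomial_right:
  assumes "t \<le> x" "\<And>y. x < y \<Longrightarrow> g x < g y"
  shows "(g_quotient g (g_monomial g t (Suc n)) x \<longlongrightarrow> real (Suc n) * g_monomial g t n x) (at_right x)"
    (is "(?Q \<longlongrightarrow> ?L) _")
proof -
  have ev: "\<forall>\<^sub>F y in at_right x. x < y \<and> y < x + 1"
    using eventually_at_right_field by (force intro: exI[of _ "x + 1"])
  have lower: "\<forall>\<^sub>F y in at_right x. ?L \<le> ?Q y"
    using ev
  proof eventually_elim
    case (elim y)
    with g_monomial_Suc_diff_ge[of t x y n] assms show ?case
      by (simp add: g_quotient_def field_simps del: g_monomial.simps of_nat_Suc)
  qed
  show ?thesis
  proof (cases "jump g x = 0")
    case True
    show ?thesis
    proof (rule tendsto_sandwich[OF lower _ tendsto_const])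
      show "((\<lambda>y. real (Suc n) * g_monomial g t n y) \<longlongrightarrow> ?L) (at_right x)"
        by (intro tendsto_intros g_monomial_tendsto_right assms True)
      show "\<forall>\<^sub>F y in at_right x. ?Q y \<le> real (Suc n) * g_monomial g t n y"
        using ev
      proof eventually_elim
        case (elim y)
        with g_monomial_Suc_diff_le[of t x y y n] assms show ?case
          by (simp add: g_quotient_def field_simps del: g_monomial.simps of_nat_Suc)
      qed
    qed
  next
    case False
    \<comment> \<open>The value at \<open>x + 1\<close> only has to be a fixed upper bound: its
      weight \<open>g y - g x - jump g x\<close> tends to 0.\<close>
    let ?U = "\<lambda>y. real (Suc n) * (g_monomial g t n x * jump g x
      + g_monomial g t n (x + 1) * (g y - g x - jump g x)) / (g y - g x)"
    show ?thesis
    proof (rule tendsto_sandwich[OF lower _ tendsto_const])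
      have "(?U \<longlongrightarrow> real (Suc n) * (g_monomial g t n x * jump g x
          + g_monomial g t n (x + 1) * (jump g x - jump g x)) / jump g x) (at_right x)"
        using False by (intro tendsto_intros derivator_increment_tendsto_jump)
      then show "(?U \<longlongrightarrow> ?L) (at_right x)"
        using False by simp
      show "\<forall>\<^sub>F y in at_right x. ?Q y \<le> ?U y"
        using ev
      proof eventually_elim
        case (elim y)
        with g_monomial_Suc_diff_le_jump[of t x y "x + 1" n] assms show ?case
          by (simp add: g_quotient_def divide_right_mono less_imp_le del: g_monomial.simps of_nat_Suc)
      qed
    qed
  qed
qed

subsection \<open>Components of the constancy set\<close>

text \<open>A monotone function with equal values at two points is constant between them.\<close>

lemma constancy_setI:
  assumes "g a = g b" "a < x" "x < b"
  shows "x \<in> constancy_set g"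
proof -
  define \<epsilon> where "\<epsilon> = min (x - a) (b - x)"
  have "g s = g a" if "s \<in> {x - \<epsilon><..<x + \<epsilon>}" for s
    using that assms derivator_le[of a s] derivator_le[of s b] by (auto simp: \<epsilon>_def min_def split: if_splits)
  then have "g constant_on {x - \<epsilon><..<x + \<epsilon>}"
    by (auto simp: constant_on_def)
  then show ?thesis
    using assms by (auto simp: constancy_set_def \<epsilon>_def intro!: exI[of _ \<epsilon>])
qed

lemma open_constancy_set: "open (constancy_set g)"
proof (subst open_subopen, intro ballI)
  fix x assume "x \<in> constancy_set g"
  then obtain \<epsilon> where \<epsilon>: "\<epsilon> > 0" "g constant_on {x - \<epsilon><..<x + \<epsilon>}"
    by (auto simp: constancy_set_def)
  have "y \<in> constancy_set g" if y: "y \<in> {x - \<epsilon><..<x + \<epsilon>}" for y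
  proof -
    obtain a b where "x - \<epsilon> < a" "a < y" "y < b" "b < x + \<epsilon>"
      using y dense[of "x - \<epsilon>" y] dense[of y "x + \<epsilon>"] by auto
    moreover from this have "g a = g b"
      using \<epsilon>(2) by (auto simp: constant_on_def)
    ultimately show ?thesis by (intro constancy_setI[of a b])
  qed
  with \<epsilon>(1) show "\<exists>T. open T \<and> x \<in> T \<and> T \<subseteq> constancy_set g"
    by (intro exI[of _ "{x - \<epsilon><..<x + \<epsilon>}"]) auto
qed

lemma constant_on_constancy_segment:
  assumes "{a..b} \<subseteq> constancy_set g" "a \<le> b"
  shows "g a = g b"
proof -
  have "g constant_on {a..b}"
  proof (rule locally_constant_imp_constant)
    fix c assume c: "c \<in> {a..b}"
    then obtain \<epsilon> where \<epsilon>: "\<epsilon> > 0" "g constant_on {c - \<epsilon><..<c + \<epsilon>}"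
      using assms by (auto simp: constancy_set_def)
    have const: "g s = g c" if "s \<in> {c - \<epsilon><..<c + \<epsilon>}" for s
    proof -
      have "c \<in> {c - \<epsilon><..<c + \<epsilon>}" using \<epsilon>(1) by simp
      with that \<epsilon>(2) show ?thesis unfolding constant_on_def by metis
    qed
    from \<epsilon>(1) c show "\<exists>T. openin (top_of_set {a..b}) T \<and> c \<in> T \<and> (\<forall>x\<in>T. g x = g c)"
      by (intro exI[of _ "{a..b} \<inter> {c - \<epsilon><..<c + \<epsilon>}"]) (auto intro!: openin_open_Int const)
  qed simp
  then obtain c where "\<forall>s\<in>{a..b}. g s = c"
    unfolding constant_on_def by (elim exE)
  with assms(2) have "g a = c" "g b = c" by auto
  then show ?thesis by simp
qed

lemma open_component_constancy_set: "C \<in> components (constancy_set g) \<Longrightarrow> open C"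
  by (rule open_components[OF open_constancy_set])

lemma component_constant:
  assumes "C \<in> components (constancy_set g)" "x \<in> C" "y \<in> C"
  shows "g x = g y"
proof -
  have "g x = g y" if "x \<le> y" "x \<in> C" "y \<in> C" for x y
    using that assms(1) connected_contains_Icc[of C x y] in_components_connected[of C]
      in_components_subset[of C] by (intro constant_on_constancy_segment) auto
  from this[of x y] this[of y x] assms show ?thesis by linarith
qed

text \<open>Left-continuity carries the value of \<open>g\<close> on the component to
  \<open>b\<close>. If \<open>b\<close> were in the constancy set, maximality would put
  \<open>{x..b}\<close> inside \<open>C\<close>, although openness keeps every point of
  \<open>C\<close> strictly below \<open>b\<close>. A plateau starting at \<open>b\<close> would
  join the one on its left and put \<open>b\<close> in the constancy set, so \<open>g\<close>
  increases strictly after \<open>b\<close>.\<close>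

lemma right_end_component:
  assumes C: "C \<in> components (constancy_set g)" "x \<in> C" and b: "right_end C = ereal b"
  shows "x < b" "g b = g x" "\<And>y. b < y \<Longrightarrow> g b < g y"
proof -
  have lt: "c < b" if c: "c \<in> C" for c
  proof -
    obtain e where e: "e > 0" "ball c e \<subseteq> C"
      using open_component_constancy_set[OF C(1)] c open_contains_ball by blast
    then have "c + e / 2 \<in> C" by (auto simp: dist_real_def subset_eq)
    then have "ereal (c + e / 2) \<le> ereal b"
      using b by (auto simp: right_end_def simp flip: b intro: Sup_upper)
    with e(1) show ?thesis by simp
  qed
  show "x < b" by (rule lt[OF C(2)])
  have const: "g s = g x" "s \<in> C" if s: "s \<in> {x..<b}" for s
  proof -
    have "ereal s < Sup (ereal ` C)"
      using s b by (simp add: right_end_def)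
    then obtain c where "c \<in> C" "s < c" by (auto simp: less_Sup_iff)
    then show "s \<in> C"
      using C s connected_contains_Icc[of C x c] in_components_connected[OF C(1)] by auto
    then show "g s = g x" by (rule component_constant[OF C(1) _ C(2)])
  qed
  have ev: "\<forall>\<^sub>F s in at_left b. g s = g x"
    unfolding eventually_at_left_field
    by (rule exI[of _ x]) (auto intro: const(1) lt[OF C(2)])
  have "((\<lambda>s. g x) \<longlongrightarrow> g b) (at_left b)"
    using tendsto_cong[OF ev] derivator_tendsto_left[of b] by simp
  then show gb: "g b = g x"
    by (auto simp: tendsto_const_iff)
  have "b \<notin> constancy_set g"
  proof
    assume "b \<in> constancy_set g"
    then have "{x..b} \<subseteq> constancy_set g"
      using const(2) in_components_subset[OF C(1)]
      by (force simp: le_less)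
    then have "{x..b} \<subseteq> C"
      using C lt[OF C(2)] by (intro components_maximal[OF C(1)]) auto
    then have "b \<in> C" using lt[OF C(2)] by auto
    with lt[of b] show False by simp
  qed
  then show "g b < g y" if "b < y" for y
    using constancy_setI[of x y b] that lt[OF C(2)] gb derivator_le[of b y] by fastforce
qed

text \<open>The derivator is in general only left-continuous; the absence of a jump at
  \<open>a\<close> supplies the right-continuity that carries the value on the component to
  \<open>a\<close>.\<close>

lemma left_end_component:
  assumes C: "C \<in> components (constancy_set g)" "x \<in> C" and a: "left_end C = ereal a"
    and "jump g a = 0"
  shows "a < x" "g a = g x"
proof -
  obtain e where e: "e > 0" "ball x e \<subseteq> C"
    using open_component_constancy_set[OF C(1)] C(2) open_contains_ball by blast
  then have "x - e / 2 \<in> C" by (auto simp: dist_real_def subset_eq)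
  then have "ereal a \<le> ereal (x - e / 2)"
    by (auto simp: left_end_def simp flip: a intro: Inf_lower)
  with e(1) show "a < x" by simp
  have const: "g s = g x" if s: "s \<in> {a<..x}" for s
  proof -
    have "Inf (ereal ` C) < ereal s"
      using s a by (simp add: left_end_def)
    then obtain c where "c \<in> C" "c < s" by (auto simp: Inf_less_iff)
    then have "s \<in> C"
      using C s connected_contains_Icc[of C c x] in_components_connected[OF C(1)] by auto
    then show "g s = g x" by (rule component_constant[OF C(1) _ C(2)])
  qed
  have ev: "\<forall>\<^sub>F s in at_right a. g s = g x"
    using \<open>a < x\<close> unfolding eventually_at_right_field
    by (intro exI[of _ x]) (auto intro: const)
  have "(g \<longlongrightarrow> g a) (at_right a)"
    using derivator_tendsto_right[of a] \<open>jump g a = 0\<close> by (simp add: jump_eq_measure)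
  then have "((\<lambda>s. g x) \<longlongrightarrow> g a) (at_right a)"
    using tendsto_cong[OF ev] by simp
  then show "g a = g x"
    by (auto simp: tendsto_const_iff)
qed

text \<open>A point outside the constancy set cannot have plateaus on both sides. A plateau on the
  left thus forces strict increase on the right, the side from which the derivative is taken;
  \<open>N_minus_flat_right\<close> is the mirror image.\<close>

lemma N_plus_flat_left:
  assumes "x \<in> N_plus g" shows "\<exists>y<x. g y = g x"
proof -
  obtain C where C: "C \<in> components (constancy_set g)" "right_end C = ereal x"
    using assms unfolding N_plus_def by force
  then show ?thesis
    using right_end_component[of C _ x] in_components_nonempty[OF C(1)] by (metis ex_in_conv)
qed

lemma N_minus_flat_right:
  assumes "x \<in> N_minus g" shows "\<exists>y>x. g y = g x"
proof -
  obtain C where C: "C \<in> components (constancy_set g)" "left_end C = ereal x" "jump g x = 0"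
    using assms jump_nonneg[of x] unfolding N_minus_def jump_set_def by force
  then show ?thesis
    using left_end_component[of C _ x] in_components_nonempty[OF C(1)] by (metis ex_in_conv)
qed

text \<open>The interval \<open>{x<..<y}\<close> lies in one component, which cannot reach
  \<open>x\<close>, so \<open>x\<close> is its left end. With the mirrored
  \<open>flat_left_N_plus\<close>, this gives strict increase on both sides at the points where the
  two-sided limit is taken.\<close>

lemma flat_right_N_minus:
  assumes "x < y" "g y = g x" "x \<notin> jump_set g" "x \<notin> constancy_set g"
  shows "x \<in> N_minus g"
proof -
  have sub: "{x<..<y} \<subseteq> constancy_set g"
    using assms(2) by (auto intro: constancy_setI[of x y])
  moreover have "constancy_set g \<noteq> {}"
    using sub dense[OF assms(1)] by auto
  ultimately obtain C where C: "C \<in> components (constancy_set g)" "{x<..<y} \<subseteq> C"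
    using exists_component_superset[of "{x<..<y}" "constancy_set g"] by auto
  have "x < c" if c: "c \<in> C" for c
  proof (rule ccontr)
    assume "\<not> x < c"
    moreover obtain s where s: "x < s" "s < y" using dense[OF assms(1)] by auto
    moreover have "s \<in> C" using s C(2) by auto
    ultimately have "x \<in> C"
      using C c connected_contains_Icc[of C c s] in_components_connected[OF C(1)] by auto
    with assms(4) in_components_subset[OF C(1)] show False by auto
  qed
  then have "ereal x \<le> left_end C"
    unfolding left_end_def by (intro Inf_greatest) (auto intro: less_imp_le)
  moreover have "left_end C \<le> ereal x"
  proof (rule ccontr)
    assume "\<not> left_end C \<le> ereal x"
    \<comment> \<open>Were the infimum above \<open>x\<close>, some point of
      \<open>{x<..<y}\<close>, hence of \<open>C\<close>, would lie below it.\<close>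
    then have "ereal x < min (left_end C) (ereal y)" using assms(1) by auto
    then obtain s where "ereal x < ereal s" "ereal s < min (left_end C) (ereal y)"
      by (metis ereal_dense2)
    moreover from this have "left_end C \<le> ereal s"
      unfolding left_end_def using C(2) by (intro Inf_lower) auto
    ultimately show False by auto
  qed
  ultimately have "left_end C = ereal x" by (rule antisym[rotated])
  with C(1) assms(3) show ?thesis
    unfolding N_minus_def by (auto intro!: bexI[of _ C])
qed

lemma flat_left_N_plus:
  assumes "y < x" "g y = g x" "x \<notin> jump_set g" "x \<notin> constancy_set g"
  shows "x \<in> N_plus g"
proof -
  have sub: "{y<..<x} \<subseteq> constancy_set g"
    using assms(2) by (auto intro: constancy_setI[of y x])
  moreover have "constancy_set g \<noteq> {}"
    using sub dense[OF assms(1)] by auto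
  ultimately obtain C where C: "C \<in> components (constancy_set g)" "{y<..<x} \<subseteq> C"
    using exists_component_superset[of "{y<..<x}" "constancy_set g"] by auto
  have "c < x" if c: "c \<in> C" for c
  proof (rule ccontr)
    assume "\<not> c < x"
    moreover obtain s where s: "y < s" "s < x" using dense[OF assms(1)] by auto
    moreover have "s \<in> C" using s C(2) by auto
    ultimately have "x \<in> C"
      using C c connected_contains_Icc[of C s c] in_components_connected[OF C(1)] by auto
    with assms(4) in_components_subset[OF C(1)] show False by auto
  qed
  then have "right_end C \<le> ereal x"
    unfolding right_end_def by (intro Sup_least) (auto intro: less_imp_le)
  moreover have "ereal x \<le> right_end C"
  proof (rule ccontr)
    assume "\<not> ereal x \<le> right_end C"
    then have "max (right_end C) (ereal y) < ereal x" using assms(1) by auto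
    then obtain s where "ereal s < ereal x" "max (right_end C) (ereal y) < ereal s"
      by (metis ereal_dense2)
    moreover from this have "ereal s \<le> right_end C"
      unfolding right_end_def using C(2) by (intro Sup_upper) auto
    ultimately show False by auto
  qed
  ultimately have "right_end C = ereal x" by (rule antisym)
  with C(1) assms(3) show ?thesis
    unfolding N_plus_def by (auto intro!: bexI[of _ C])
qed

text \<open>If \<open>g c = g x\<close> with \<open>c\<close> at or beyond \<open>r\<close>, then
  \<open>g\<close>, and with it the continuous part, would agree at \<open>x\<close> and
  \<open>r\<close>. Applied to the points of \<open>C\<close> this makes the right end finite;
  applied to \<open>b\<close> it gives strictness.\<close>

lemma right_end_component_less:
  assumes C: "C \<in> components (constancy_set g)" "x \<in> C"
    and r: "x < r" "cont_part g x < cont_part g r"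
  obtains b where "right_end C = ereal b" "b < r"
proof -
  have less: "c < r" if "g c = g x" for c
  proof (rule ccontr)
    assume "\<not> c < r"
    with that r(1) have "g x = g r"
      using derivator_le[of x r] derivator_le[of r c] by simp
    with r cont_part_eq[of x r] show False by simp
  qed
  have "right_end C \<le> ereal r"
    unfolding right_end_def
    by (intro Sup_least) (auto intro!: less_imp_le[OF less] component_constant[OF C(1) _ C(2)])
  moreover have "ereal x \<le> right_end C"
    unfolding right_end_def using C(2) by (intro Sup_upper) auto
  ultimately obtain b where b: "right_end C = ereal b"
    by (cases "right_end C") auto
  show thesis by (rule that[OF b less[OF right_end_component(2)[OF C b]]])
qed

subsection \<open>Termwise differentiation of series in the monomials\<close>

text \<open>Justifies the definite description in \<open>g_deriv\<close>. On a constancy interval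
  the component through \<open>x\<close>, and so the base point \<open>b\<close>, is determined by
  \<open>x\<close>.\<close>

lemma has_g_derivative_unique:
  assumes "has_g_derivative g f x L" "has_g_derivative g f x L'"
  shows "L = L'"
proof (cases "x \<in> constancy_set g \<and> x \<notin> jump_set g")
  case True
  then obtain C b C' b' where *: "C \<in> components (constancy_set g)" "x \<in> C"
      "right_end C = ereal b" "(g_quotient g f b \<longlongrightarrow> L) (at_right b)"
      "C' \<in> components (constancy_set g)" "x \<in> C'"
      "right_end C' = ereal b'" "(g_quotient g f b' \<longlongrightarrow> L') (at_right b')"
    using assms unfolding has_g_derivative_def by auto
  then have "C' = C" using components_eq by blast
  with * show ?thesis using tendsto_unique[of "at_right b"] by auto
next
  case False
  with assms show ?thesis
    unfolding has_g_derivative_def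
    by (auto split: if_splits intro: tendsto_unique[OF trivial_limit_at_right_real]
        tendsto_unique[OF trivial_limit_at_left_real] tendsto_unique[OF at_neq_bot])
qed

lemma has_g_derivative_imp_g_deriv: "has_g_derivative g f x L \<Longrightarrow> g_deriv g f x = L"
  unfolding g_deriv_def by (rule the_equality) (assumption, rule has_g_derivative_unique)

text \<open>The monomial is Lipschitz with respect to \<open>g\<close> on \<open>{t..v}\<close>. The
  bound is independent of \<open>y\<close>, as dominated passage to the limit demands.\<close>

lemma abs_g_quotient_g_monomial_le:
  assumes "t \<le> x" "x \<le> v" "t \<le> y" "y \<le> v"
  shows "\<bar>g_quotient g (g_monomial g t (Suc n)) x y\<bar> \<le> real (Suc n) * g_monomial g t n v"
proof -
  let ?M = "g_monomial g t"
  have *: "0 \<le> ?M (Suc n) y - ?M (Suc n) x"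
      "?M (Suc n) y - ?M (Suc n) x \<le> real (Suc n) * ?M n v * (g y - g x)"
    if "t \<le> x" "x \<le> y" "y \<le> v" for x y
    using g_monomial_Suc_diff_le[of t x y v n] g_monomial_mono[of t x y "Suc n"] that
    by (simp_all add: mult.assoc del: g_monomial.simps of_nat_Suc)
  have "\<bar>?M (Suc n) y - ?M (Suc n) x\<bar> \<le> real (Suc n) * ?M n v * \<bar>g y - g x\<bar>"
  proof (cases "x \<le> y")
    case True
    with *[of x y] assms derivator_le[of x y] show ?thesis
      by (simp del: g_monomial.simps of_nat_Suc)
  next
    case False
    with *[of y x] assms derivator_le[of y x] show ?thesis
      by (simp add: abs_minus_commute del: g_monomial.simps of_nat_Suc)
  qed
  moreover have "0 \<le> real (Suc n) * ?M n v"
    using assms by (intro mult_nonneg_nonneg g_monomial_nonneg) auto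
  ultimately show ?thesis
    \<comment> \<open>For equal values of \<open>g\<close> the quotient is a division by zero, hence
      0.\<close>
    by (cases "g y = g x")
      (simp_all add: g_quotient_def divide_le_eq del: g_monomial.simps of_nat_Suc)
qed

text \<open>As \<open>g_monomial g t (Suc n) x\<close> is nonnegative, the monomial at
  \<open>z\<close> bounds its own increment from \<open>x\<close> to \<open>z\<close>. Each term is
  thus compared with a term of the shifted series at \<open>z\<close>, divided by
  \<open>g z - g x\<close>.\<close>

lemma summable_g_series_derivative:
  fixes a :: "nat \<Rightarrow> 'a::{real_normed_field, banach}"
  assumes "t \<le> x" "x \<le> z" "g x < g z"
    and summable: "summable (\<lambda>n. norm (a n * of_real (g_monomial g t n z)))"
  shows "summable (\<lambda>n. norm (of_nat (Suc n) * a (Suc n) * of_real (g_monomial g t n x)))"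
proof (rule summable_comparison_test')
  show "summable (\<lambda>n. norm (a (Suc n) * of_real (g_monomial g t (Suc n) z)) / (g z - g x))"
    using summable by (intro summable_divide) (subst summable_Suc_iff)
  fix n :: nat
  have nonneg: "0 \<le> g_monomial g t n x" "0 \<le> g_monomial g t (Suc n) x"
      "0 \<le> g_monomial g t (Suc n) z"
    using assms by (auto intro!: g_monomial_nonneg simp del: g_monomial.simps)
  have "real (Suc n) * g_monomial g t n x \<le> g_monomial g t (Suc n) z / (g z - g x)"
    using g_monomial_Suc_diff_ge[of t x z n] assms nonneg
    by (simp add: pos_le_divide_eq mult.assoc del: g_monomial.simps of_nat_Suc)
  then have "norm (a (Suc n)) * (real (Suc n) * g_monomial g t n x)
      \<le> norm (a (Suc n)) * (g_monomial g t (Suc n) z / (g z - g x))"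
    by (rule mult_left_mono) simp
  then show "norm (norm (of_nat (Suc n) * a (Suc n) * of_real (g_monomial g t n x)))
      \<le> norm (a (Suc n) * of_real (g_monomial g t (Suc n) z)) / (g z - g x)"
    using nonneg by (simp add: norm_mult ac_simps del: g_monomial.simps of_nat_Suc)
qed

text \<open>The terms of the derivative series at the fixed point \<open>v\<close> dominate all
  quotients with \<open>y \<le> v\<close>. Limits from the left use \<open>v = x\<close>; limits
  from the right use some \<open>v\<close> beyond \<open>x\<close>.\<close>

lemma g_quotient_g_series_tendsto:
  fixes a :: "nat \<Rightarrow> 'a::{real_normed_field, banach}"
  assumes series: "g_series_on g t a f {t<..<r}"
    and "t < x" "x \<le> v" "v < r"
    and summable: "summable (\<lambda>n. norm (of_nat (Suc n) * a (Suc n) * of_real (g_monomial g t n v)))"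
    and F: "F \<noteq> bot" "\<forall>\<^sub>F y in F. t < y \<and> y \<le> v"
    and lim: "\<And>n. (g_quotient g (g_monomial g t (Suc n)) x
      \<longlongrightarrow> real (Suc n) * g_monomial g t n x) F"
  shows "(g_quotient g f x
    \<longlongrightarrow> (\<Sum>n. of_nat (Suc n) * a (Suc n) * of_real (g_monomial g t n x))) F"
proof -
  let ?M = "g_monomial g t"
  let ?q = "\<lambda>n y. a (Suc n) * of_real (g_quotient g (?M (Suc n)) x y)"
  have quotient: "(\<Sum>n. ?q n y) = g_quotient g f x y" if "t < y" "y \<le> v" for y
  proof -
    have "(\<lambda>n. a n * of_real (?M n y) - a n * of_real (?M n x)) sums (f y - f x)"
      using series assms(2-4) that by (intro sums_diff) (auto simp: g_series_on_def)
    \<comment> \<open>The zeroth monomial is constant, so the term of index 0 in the difference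
      vanishes and the index can be shifted.\<close>
    then have "(\<lambda>n. a (Suc n) * of_real (?M (Suc n) y) - a (Suc n) * of_real (?M (Suc n) x))
        sums (f y - f x)"
      by (subst sums_Suc_iff) simp
    from sums_divide[OF this, of "of_real (g y - g x)"] show ?thesis
      by (intro sums_unique[symmetric])
        (simp add: g_quotient_def right_diff_distrib del: g_monomial.simps of_nat_Suc)
  qed
  have "((\<lambda>y. \<Sum>n. ?q n y) \<longlongrightarrow> (\<Sum>n. a (Suc n) * of_real (real (Suc n) * ?M n x))) F"
  proof (rule tannerys_theorem[THEN conjunct2, THEN conjunct2, OF _ _ summable F(1)])
    show "((\<lambda>y. ?q n y) \<longlongrightarrow> a (Suc n) * of_real (real (Suc n) * ?M n x)) F" for n
      by (intro tendsto_mult tendsto_const tendsto_of_real lim)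
    have bound: "norm (?q n y) \<le> norm (of_nat (Suc n) * a (Suc n) * of_real (?M n v))"
      if "t < y" "y \<le> v" for n y
    proof -
      have "norm (?q n y) = norm (a (Suc n)) * \<bar>g_quotient g (?M (Suc n)) x y\<bar>"
        by (simp add: norm_mult del: g_monomial.simps)
      also have "\<dots> \<le> norm (a (Suc n)) * (real (Suc n) * ?M n v)"
        using that assms(2,3) by (intro mult_left_mono abs_g_quotient_g_monomial_le) auto
      also have "\<dots> = norm (of_nat (Suc n) * a (Suc n) * of_real (?M n v))"
        using g_monomial_nonneg[of t v n] assms(2,3)
        by (simp add: norm_mult del: of_nat_Suc)
      finally show ?thesis .
    qed
    show "\<forall>\<^sub>F (n, y) in sequentially \<times>\<^sub>F F.
        norm (?q n y) \<le> norm (of_nat (Suc n) * a (Suc n) * of_real (?M n v))"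
      unfolding eventually_prod_filter using F(2) bound
      by (intro exI[of _ "\<lambda>_. True"] exI[of _ "\<lambda>y. t < y \<and> y \<le> v"]) auto
  qed
  then have "((\<lambda>y. \<Sum>n. ?q n y)
      \<longlongrightarrow> (\<Sum>n. of_nat (Suc n) * a (Suc n) * of_real (?M n x))) F"
    by (simp add: ac_simps del: g_monomial.simps)
  moreover have "\<forall>\<^sub>F y in F. (\<Sum>n. ?q n y) = g_quotient g f x y"
    using F(2) by eventually_elim (rule quotient, auto)
  ultimately show ?thesis
    using tendsto_cong by fast
qed

section \<open>The derivative of a fixed series\<close>

context
  fixes a :: "nat \<Rightarrow> 'a::{real_normed_field, banach}" and f :: "real \<Rightarrow> 'a" and t r :: real
  assumes series: "g_series_on g t a f {t<..<r}"
begin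

lemma summable_g_series_derivative_below:
  assumes "t < x" "x < r" "cont_part g x < cont_part g r"
  shows "summable (\<lambda>n. norm (of_nat (Suc n) * a (Suc n) * of_real (g_monomial g t n x)))"
proof -
  obtain z where z: "x < z" "z < r" "cont_part g x < cont_part g z"
    using cont_part_between[of x r] assms by auto
  then have "g x < g z" using cont_part_increment_le[of x z] by simp
  with z assms series show ?thesis
    by (intro summable_g_series_derivative[of t x z]) (auto simp: g_series_on_def)
qed

lemma g_quotient_g_series_left:
  assumes "t < x" "x < r" "cont_part g x < cont_part g r" "\<And>y. y < x \<Longrightarrow> g y < g x"
  shows "(g_quotient g f x
    \<longlongrightarrow> (\<Sum>n. of_nat (Suc n) * a (Suc n) * of_real (g_monomial g t n x))) (at_left x)"
proof (rule g_quotient_g_series_tendsto[OF series assms(1) order_refl assms(2)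
      summable_g_series_derivative_below[OF assms(1-3)] trivial_limit_at_left_real])
  show "\<forall>\<^sub>F y in at_left x. t < y \<and> y \<le> x"
    using assms(1) unfolding eventually_at_left_field by (auto intro!: exI[of _ t])
qed (rule g_quotient_g_monomial_left[OF assms(1,4)])

lemma g_quotient_g_series_right:
  assumes "t < x" "x < r" "cont_part g x < cont_part g r" "\<And>y. x < y \<Longrightarrow> g x < g y"
  shows "(g_quotient g f x
    \<longlongrightarrow> (\<Sum>n. of_nat (Suc n) * a (Suc n) * of_real (g_monomial g t n x))) (at_right x)"
proof -
  obtain v where v: "x < v" "v < r" "cont_part g v < cont_part g r"
    using cont_part_between[of x r] assms by auto
  have "t < v" using assms(1) v(1) by simp
  show ?thesis
  proof (rule g_quotient_g_series_tendsto[OF series assms(1) less_imp_le[OF v(1)] v(2)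
        summable_g_series_derivative_below[OF \<open>t < v\<close> v(2,3)] trivial_limit_at_right_real])
    show "\<forall>\<^sub>F y in at_right x. t < y \<and> y \<le> v"
      using assms(1) v(1) unfolding eventually_at_right_field by (auto intro!: exI[of _ v])
  qed (rule g_quotient_g_monomial_right[OF less_imp_le[OF assms(1)] assms(4)])
qed

text \<open>In each case \<open>g\<close> increases strictly on every side from which the limit is
  taken, so the one-sided results apply.\<close>

lemma has_g_derivative_g_series:
  assumes x: "t < x" "x < r" "cont_part g x < cont_part g r"
  shows "has_g_derivative g f x (\<Sum>n. of_nat (Suc n) * a (Suc n) * of_real (g_monomial g t n x))"
    (is "has_g_derivative g f x (?h x)")
proof -
  have strict: "g x < g y" if "x < y" "g y \<noteq> g x" for x y
    using that derivator_le[of x y] by simp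
  consider (jump) "x \<in> jump_set g"
    | (constancy) "x \<notin> jump_set g" "x \<in> constancy_set g"
    | (plus) "x \<notin> jump_set g" "x \<notin> constancy_set g" "x \<in> N_plus g"
    | (minus) "x \<notin> jump_set g" "x \<notin> constancy_set g" "x \<notin> N_plus g" "x \<in> N_minus g"
    | (regular) "x \<notin> jump_set g" "x \<notin> constancy_set g" "x \<notin> N_plus g" "x \<notin> N_minus g"
    by blast
  then show ?thesis
  proof cases
    case jump
    then have "g x < g y" if "x < y" for y
      using jump_le[OF that] by (simp add: jump_set_def)
    with jump show ?thesis
      by (simp add: has_g_derivative_def g_quotient_g_series_right[OF x] del: of_nat_Suc)
  next
    case constancy
    then obtain C where C: "C \<in> components (constancy_set g)" "x \<in> C"
      using Union_components[of "constancy_set g"] by blast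
    obtain b where b: "right_end C = ereal b" "b < r"
      by (rule right_end_component_less[OF C x(2,3)])
    note b' = right_end_component[OF C b(1)]
    \<comment> \<open>Increments of monomials are controlled by those of \<open>g\<close>, which
      vanish from \<open>x\<close> to \<open>b\<close>. The limit at \<open>b\<close> is therefore
      the value of the derivative series at \<open>x\<close>.\<close>
    have "g_monomial g t n b = g_monomial g t n x" for n
    proof (cases n)
      case (Suc m)
      with g_monomial_Suc_diff_le[of t x b b m] g_monomial_mono[of t x b n] b' x(1)
      show ?thesis by (simp del: g_monomial.simps)
    qed simp
    moreover have "cont_part g b = cont_part g x"
      using cont_part_eq[of x b] b' by simp
    ultimately have "(g_quotient g f b \<longlongrightarrow> ?h x) (at_right b)"
      using g_quotient_g_series_right[of b] b' b x by (simp del: of_nat_Suc)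
    with constancy C b(1) show ?thesis
      unfolding has_g_derivative_def by auto
  next
    case plus
    then have "g x < g y" if "x < y" for y
      using N_plus_flat_left[of x] constancy_setI[of _ y x] strict[OF that] that by metis
    with plus show ?thesis
      by (simp add: has_g_derivative_def g_quotient_g_series_right[OF x] del: of_nat_Suc)
  next
    case minus
    then have "g y < g x" if "y < x" for y
      using N_minus_flat_right[of x] constancy_setI[of y _ x] strict[OF that] that by metis
    with minus show ?thesis
      by (simp add: has_g_derivative_def g_quotient_g_series_left[OF x] del: of_nat_Suc)
  next
    case regular
    then have "g x < g y" if "x < y" for y
      using flat_right_N_minus[OF that] strict[OF that] by blast
    moreover from regular have "g y < g x" if "y < x" for y
      using flat_left_N_plus[OF that] strict[OF that] by metis
    ultimately show ?thesis
      using regular by (simp add: has_g_derivative_def filterlim_split_at_real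
          g_quotient_g_series_right[OF x] g_quotient_g_series_left[OF x] del: of_nat_Suc)
  qed
qed

text \<open>Monotonicity of the continuous part passes the strict inequality from \<open>w\<close>
  to all points before \<open>w\<close>, so one coefficient sequence serves on all of
  \<open>{t<..<w}\<close>.\<close>

lemma g_series_on_g_deriv:
  assumes "w < r" "cont_part g w < cont_part g r"
  shows "g_series_on g t (\<lambda>n. of_nat (Suc n) * a (Suc n)) (g_deriv g f) {t<..<w}"
  unfolding g_series_on_def
proof (intro ballI conjI)
  fix x assume "x \<in> {t<..<w}"
  then have x: "t < x" "x < r" "cont_part g x < cont_part g r"
    using assms cont_part_le[of x w] by auto
  show summable:
    "summable (\<lambda>n. norm (of_nat (Suc n) * a (Suc n) * of_real (g_monomial g t n x)))"
    by (rule summable_g_series_derivative_below[OF x])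
  show "(\<lambda>n. of_nat (Suc n) * a (Suc n) * of_real (g_monomial g t n x)) sums g_deriv g f x"
    using summable_sums[OF summable_norm_cancel[OF summable]]
      has_g_derivative_imp_g_deriv[OF has_g_derivative_g_series[OF x]] by simp
qed

end

section \<open>Consequences of property (H)\<close>

lemma property_HE:
  assumes "property_H g \<Omega> f" "y \<in> \<Omega>"
  obtains t r a where "t < y" "y < r" "cont_part g y < cont_part g r" "{t<..<r} \<subseteq> \<Omega>"
    "g_series_on g t a f {t<..<r}"
proof -
  from bspec[OF assms(1)[unfolded property_H_def] assms(2)] obtain \<delta> t a
    where "y \<in> {t<..<t + \<delta>}" "cont_part g y < cont_part g (t + \<delta>)"
      "{t<..<t + \<delta>} \<subseteq> \<Omega>" "g_series_on g t a f {t<..<t + \<delta>}"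
    by (elim exE conjE)
  then show thesis by (intro that[of t "t + \<delta>"]) auto
qed

text \<open>The interval that (H) provides around \<open>x\<close> reaches beyond the right end of
  the component of \<open>x\<close>.\<close>

lemma property_H_imp_contains_right_ends:
  assumes "property_H g \<Omega> f"
  shows "contains_right_ends g \<Omega>"
  unfolding contains_right_ends_def
proof (intro ballI impI)
  fix x C assume x: "x \<in> \<Omega>" and C: "C \<in> components (constancy_set g)" "x \<in> C"
  obtain t r where tr: "t < x" "x < r" "cont_part g x < cont_part g r" "{t<..<r} \<subseteq> \<Omega>"
    by (rule property_HE[OF assms x])
  obtain b where b: "right_end C = ereal b" "b < r"
    by (rule right_end_component_less[OF C tr(2,3)])
  with right_end_component(1)[OF C b(1)] tr have "b \<in> \<Omega>" by auto
  with b(1) show "right_end C \<in> ereal ` \<Omega>" by simp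
qed

lemma property_H_imp_g_differentiable_on:
  fixes f :: "real \<Rightarrow> 'a::{real_normed_field, banach}"
  assumes "property_H g \<Omega> f"
  shows "g_differentiable_on g f \<Omega>"
  unfolding g_differentiable_on_def
proof
  fix y assume "y \<in> \<Omega>"
  obtain t r a where tr: "t < y" "y < r" "cont_part g y < cont_part g r"
      and series: "g_series_on g t a f {t<..<r}"
    by (rule property_HE[OF assms \<open>y \<in> \<Omega>\<close>])
  show "\<exists>L. has_g_derivative g f y L"
    by (rule exI, rule has_g_derivative_g_series[OF series tr])
qed

lemma property_H_g_deriv:
  fixes f :: "real \<Rightarrow> 'a::{real_normed_field, banach}"
  assumes "property_H g \<Omega> f"
  shows "property_H g \<Omega> (g_deriv g f)"
  unfolding property_H_def
proof
  fix y assume "y \<in> \<Omega>"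
  obtain t r a where tr: "t < y" "y < r" "cont_part g y < cont_part g r" "{t<..<r} \<subseteq> \<Omega>"
      and series: "g_series_on g t a f {t<..<r}"
    by (rule property_HE[OF assms \<open>y \<in> \<Omega>\<close>])
  \<comment> \<open>The inequality between \<open>y\<close> and \<open>w\<close> is (H) for the
    derivative on the shorter interval; the one between \<open>w\<close> and \<open>r\<close> makes
    the derivative series valid there.\<close>
  obtain w where w: "y < w" "w < r" "cont_part g y < cont_part g w"
      "cont_part g w < cont_part g r"
    using cont_part_between[of y r] tr by auto
  show "\<exists>\<delta>>0. \<exists>t. y \<in> {t<..<t + \<delta>} \<and> cont_part g y < cont_part g (t + \<delta>) \<and>
      {t<..<t + \<delta>} \<subseteq> \<Omega> \<and> (\<exists>a. g_series_on g t a (g_deriv g f) {t<..<t + \<delta>})"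
  proof (intro exI conjI)
    show "g_series_on g t (\<lambda>n. of_nat (Suc n) * a (Suc n)) (g_deriv g f) {t<..<t + (w - t)}"
      using g_series_on_g_deriv[OF series w(2,4)] by (simp del: of_nat_Suc)
  qed (use tr w in auto)
qed

end

lemma property_H_imp_stieltjes_analytic_on:
  assumes "property_H g \<Omega> f"
  shows "stieltjes_analytic_on g \<Omega> f"
  unfolding stieltjes_analytic_on_def
proof
  fix y assume "y \<in> \<Omega>"
  from bspec[OF assms[unfolded property_H_def] this]
  show "\<exists>\<delta>>0. \<exists>t. y \<in> {t<..<t + \<delta>} \<and> {t<..<t + \<delta>} \<subseteq> \<Omega>
      \<and> (\<exists>a. g_series_on g t a f {t<..<t + \<delta>})"
    by (elim exE conjE) (intro exI conjI)
qed

theorem theorem4p15: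
  fixes g :: "real \<Rightarrow> real" and \<Omega> :: "real set"
  assumes "derivator g" and "open \<Omega>"
  shows "(\<forall>f :: real \<Rightarrow> real.
            stieltjes_analytic_on g \<Omega> f \<and> property_H g \<Omega> f \<longrightarrow>
              contains_right_ends g \<Omega> \<and>
              g_differentiable_on g f \<Omega> \<and>
              stieltjes_analytic_on g \<Omega> (g_deriv g f) \<and> property_H g \<Omega> (g_deriv g f)) \<and>
         (\<forall>f :: real \<Rightarrow> complex.
            stieltjes_analytic_on g \<Omega> f \<and> property_H g \<Omega> f \<longrightarrow>
              contains_right_ends g \<Omega> \<and>
              g_differentiable_on g f \<Omega> \<and>
              stieltjes_analytic_on g \<Omega> (g_deriv g f) \<and> property_H g \<Omega> (g_deriv g f))"
proof -
  interpret stieltjes_derivator g by unfold_locales (rule assms(1))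
  show ?thesis
    \<comment> \<open>The lemmas hold for values in any complete real normed field, so the same
      rules settle the real and the complex half.\<close>
    by (intro conjI allI impI property_H_imp_g_differentiable_on property_H_g_deriv
        property_H_imp_stieltjes_analytic_on; elim conjE)
      (rule property_H_imp_contains_right_ends | assumption)+
qed

end
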